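(* For $1<p\le2$ write $p'=p/(p-1)$. There do not exist an absolute constant $A>0$ and nonnegative numbers $c_p$ $(1<p\le2)$ with $\liminf_{p\to1+}(p')^2c_p=0$ such that $$v_p^{(2)}(f)\le A\,c_p\,I_p(f)$$ holds for all $1<p\le2$ and all continuous functions $f\in L^p([0,1]^2)$ with $I_p(f)<\infty$.
   Context: Functions are real-valued. $L^p([0,1]^2)$ is the class of measurable functions $f$ on $\mathbb{R}^2$ that are 1-periodic in each variable with $\|f\|_p=(\int_{[0,1]^2}|f|^p)^{1/p}<\infty$. For $s,t\in\mathbb{R}$, $\Delta(s,t)f(x,y)=f(x+s,y+t)-f(x+s,y)-f(x,y+t)+f(x,y)$, and $\omega(f;u,v)_p=\sup_{0\le s\le u,\,0\le t\le v}\|\Delta(s,t)f\|_p$. Set $$I_p(f)=\int_0^1\int_0^1(uv)^{-1/p}\omega(f;u,v)_p\frac{du}{u}\frac{dv}{v}.$$ For a function $f(x,y)$ on $\mathbb{R}^2$, 1-periodic in both variables, $$v_p^{(2)}(f)=\sup_{\mathcal N}\Big(\sum_{i=0}^{m-1}\sum_{j=0}^{n-1}|f(x_{i+1},y_{j+1})-f(x_{i+1},y_j)-f(x_i,y_{j+1})+f(x_i,y_j)|^p\Big)^{1/p},$$ the supremum over all nets $\mathcal N=\{(x_i,y_j):0\le i\le m,\,0\le j\le n\}$ with $x_0<x_1<\dots<x_m=x_0+1$ and $y_0<y_1<\dots<y_n=y_0+1$. *)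

theory Defs
  imports "HOL-Analysis.Analysis"
begin

definition periodic2 :: "(real \<times> real \<Rightarrow> real) \<Rightarrow> bool" where
  "periodic2 f \<longleftrightarrow> (\<forall>x y. f (x + 1, y) = f (x, y) \<and> f (x, y + 1) = f (x, y))"

(* Extended-valued root of order p; the library has no real powers on ennreal. *)
definition ennroot :: "real \<Rightarrow> ennreal \<Rightarrow> ennreal" where
  "ennroot p a = (if a = \<infinity> then \<infinity> else ennreal (enn2real a powr (1 / p)))"

definition Lp_norm2 :: "real \<Rightarrow> (real \<times> real \<Rightarrow> real) \<Rightarrow> ennreal" where
  "Lp_norm2 p f =
     ennroot p (\<integral>\<^sup>+ z \<in> {0..1} \<times> {0..1}. ennreal (\<bar>f z\<bar> powr p) \<partial>lebesgue)"

definition Lp2 :: "real \<Rightarrow> (real \<times> real \<Rightarrow> real) set" where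
  "Lp2 p = {f. f \<in> borel_measurable lebesgue \<and> periodic2 f \<and> Lp_norm2 p f < \<infinity>}"

definition mixed_diff :: "real \<Rightarrow> real \<Rightarrow> (real \<times> real \<Rightarrow> real) \<Rightarrow> real \<times> real \<Rightarrow> real" where
  "mixed_diff s t f = (\<lambda>(x, y). f (x + s, y + t) - f (x + s, y) - f (x, y + t) + f (x, y))"

definition mixed_modulus :: "real \<Rightarrow> (real \<times> real \<Rightarrow> real) \<Rightarrow> real \<Rightarrow> real \<Rightarrow> ennreal" where
  "mixed_modulus p f u v = (SUP (s, t) \<in> {0..u} \<times> {0..v}. Lp_norm2 p (mixed_diff s t f))"

definition I_functional :: "real \<Rightarrow> (real \<times> real \<Rightarrow> real) \<Rightarrow> ennreal" where
  "I_functional p f =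
     (\<integral>\<^sup>+ v \<in> {0<..<1}. (\<integral>\<^sup>+ u \<in> {0<..<1}.
        ennreal ((u * v) powr (- 1 / p)) * mixed_modulus p f u v * ennreal (1 / u) * ennreal (1 / v)
      \<partial>lborel) \<partial>lborel)"

(* A partition of a period: the values x 0 < ... < x m; x i for i > m is irrelevant. *)
definition period_partition :: "nat \<Rightarrow> (nat \<Rightarrow> real) \<Rightarrow> bool" where
  "period_partition m x \<longleftrightarrow> strict_mono_on {0..m} x \<and> x m = x 0 + 1"

definition net_sum ::
  "real \<Rightarrow> (real \<times> real \<Rightarrow> real) \<Rightarrow> nat \<Rightarrow> (nat \<Rightarrow> real) \<Rightarrow> nat \<Rightarrow> (nat \<Rightarrow> real) \<Rightarrow> real" where
  "net_sum p f m x n y =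
     (\<Sum>i<m. \<Sum>j<n. \<bar>f (x (Suc i), y (Suc j)) - f (x (Suc i), y j)
                   - f (x i, y (Suc j)) + f (x i, y j)\<bar> powr p)"

definition v2_variation :: "real \<Rightarrow> (real \<times> real \<Rightarrow> real) \<Rightarrow> ennreal" where
  "v2_variation p f =
     (SUP (m, x, n, y) \<in> {(m, x, n, y). period_partition m x \<and> period_partition n y}.
        ennreal (net_sum p f m x n y powr (1 / p)))"

definition conj_exp :: "real \<Rightarrow> real" where
  "conj_exp p = p / (p - 1)"

end

theory Submission
  imports Defs
begin

text \<open>
  The factor \<open>(p')\<^sup>2\<close> is the square of \<open>\<integral>\<^sub>0\<^sup>1 u powr (-1/p) du = p'\<close>, and one smooth function already
  shows that \<open>c\<^sub>p\<close> cannot be of smaller order than \<open>1 / (p')\<^sup>2\<close>.  For \<open>f (x, y) = cos (2 \<pi> x) * cos (2 \<pi> y)\<close> the mixed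
  modulus is at most \<open>4 \<pi>\<^sup>2 u v\<close>, for every \<open>p\<close>, because each factor is Lipschitz with constant
  \<open>2 \<pi>\<close>; the two powers \<open>u v\<close> cancel \<open>du/u dv/v\<close>, so that \<open>I_p f \<le> 4 \<pi>\<^sup>2 (p')\<^sup>2\<close>
  (lemma \<open>I_functional_le\<close>).  On the other hand the single cell with opposite corners \<open>(0, 0)\<close> and
  \<open>(1/2, 1/2)\<close> gives a variation of at least \<open>4\<close>, for every \<open>p\<close> (lemma
  \<open>v2_variation_cos_cos_ge\<close>).  An inequality \<open>v_p f \<le> A c\<^sub>p I_p f\<close> therefore forces
  \<open>(p')\<^sup>2 c\<^sub>p \<ge> 1 / (A \<pi>\<^sup>2)\<close> for all \<open>p\<close> in \<open>(1, 2]\<close>, and the lower limit cannot vanish.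
\<close>

section \<open>Bounds from pointwise estimates\<close>

lemma Lp_norm2_le:
  assumes "0 < p" "0 \<le> B" and bound: "\<And>z. \<bar>f z\<bar> \<le> B"
  shows "Lp_norm2 p f \<le> ennreal B"
proof -
  let ?Q = "{0..1} \<times> {0..1} :: (real \<times> real) set"
  let ?J = "\<integral>\<^sup>+ z \<in> ?Q. ennreal (\<bar>f z\<bar> powr p) \<partial>lebesgue"
  have Q: "?Q = cbox (0, 0) (1, 1)"
    by (simp add: cbox_Pair_eq)
  have "emeasure lborel (cbox (0, 0) (1, 1) :: (real \<times> real) set) = 1"
    by (subst emeasure_lborel_cbox) (auto simp: Basis_prod_def prod.union_disjoint)
  then have vol: "emeasure lebesgue ?Q = 1"
    unfolding Q by simp
  have "?J \<le> (\<integral>\<^sup>+ z. ennreal (B powr p) * indicator ?Q z \<partial>lebesgue)"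
    using assms by (intro nn_integral_mono mult_right_mono ennreal_leI powr_mono2) auto
  also have "\<dots> = ennreal (B powr p)"
    unfolding Q by (subst nn_integral_cmult_indicator) (use vol Q in auto)
  finally have J: "?J \<le> ennreal (B powr p)" .
  then have fin: "?J \<noteq> \<infinity>"
    using neq_top_trans[OF ennreal_neq_top] by simp
  have "enn2real ?J \<le> B powr p"
    using J by (simp add: enn2real_leI)
  then have "enn2real ?J powr (1 / p) \<le> (B powr p) powr (1 / p)"
    using assms by (intro powr_mono2) auto
  also have "\<dots> = B"
    using assms by (simp add: powr_powr)
  finally show ?thesis
    using fin unfolding Lp_norm2_def ennroot_def by (auto intro: ennreal_leI)
qed

lemma nn_integral_powr_conj_exp:
  assumes "1 < p"
  shows "(\<integral>\<^sup>+ u \<in> {0<..<1}. ennreal (u powr (- 1 / p)) \<partial>lborel) = ennreal (conj_exp p)"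
proof -
  have "((\<lambda>u. u powr (- 1 / p)) has_integral (1 powr (- 1 / p + 1) / (- 1 / p + 1))) {0..1::real}"
    using assms by (intro has_integral_powr_from_0) (auto simp: field_simps)
  moreover have "1 powr (- 1 / p + 1) / (- 1 / p + 1) = conj_exp p"
    using assms by (simp add: conj_exp_def field_simps)
  ultimately have "((\<lambda>u. u powr (- 1 / p)) has_integral conj_exp p) {0<..<1}"
    by (metis has_integral_Icc_iff_Ioo)
  moreover have "(\<lambda>u. u powr (- 1 / p) * indicator {0<..<1} u)
      = (\<lambda>u. if u \<in> {0<..<1} then u powr (- 1 / p) else 0)"
    by (auto simp: indicator_def)
  ultimately have "((\<lambda>u. u powr (- 1 / p) * indicator {0<..<1} u) has_integral conj_exp p) UNIV"
    by (simp only: has_integral_restrict_UNIV)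
  then have "(\<integral>\<^sup>+ u. ennreal (u powr (- 1 / p) * indicator {0<..<1} u) \<partial>lborel)
      = ennreal (conj_exp p)"
    by (intro nn_integral_has_integral_lborel) auto
  then show ?thesis
    by (simp add: ennreal_mult'' ennreal_indicator)
qed

lemma ennreal_mult4:
  assumes "0 \<le> a" "0 \<le> b" "0 \<le> c" "0 \<le> d"
  shows "ennreal a * ennreal b * ennreal c * ennreal d = ennreal (a * b * c * d)"
  using assms by (simp add: ennreal_mult)

text \<open>
  A modulus of size \<open>u v\<close> cancels the weight \<open>1/(u v)\<close>, which leaves the product of two copies of
  \<open>\<integral>\<^sub>0\<^sup>1 u powr (-1/p) du\<close>.
\<close>
lemma I_functional_le:
  assumes "1 < p" "0 \<le> K"
    and bound: "\<And>u v. 0 < u \<Longrightarrow> 0 < v \<Longrightarrow> mixed_modulus p f u v \<le> ennreal (K * (u * v))"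
  shows "I_functional p f \<le> ennreal (K * (conj_exp p)\<^sup>2)"
proof -
  define g where "g = (\<lambda>u::real. ennreal (u powr (- 1 / p)) * indicator {0<..<1} u)"
  have g_int: "(\<integral>\<^sup>+ u. g u \<partial>lborel) = ennreal (conj_exp p)"
    using nn_integral_powr_conj_exp[OF \<open>1 < p\<close>] by (simp add: g_def)
  have "0 \<le> conj_exp p"
    using assms by (simp add: conj_exp_def)
  have [measurable]: "g \<in> borel_measurable borel"
    unfolding g_def by measurable
  have pt: "ennreal ((u * v) powr (- 1 / p)) * mixed_modulus p f u v * ennreal (1 / u)
        * ennreal (1 / v) \<le> ennreal K * ennreal (v powr (- 1 / p)) * ennreal (u powr (- 1 / p))"
    if "0 < u" "0 < v" for u v :: real
  proof -
    have "ennreal ((u * v) powr (- 1 / p)) * mixed_modulus p f u v * ennreal (1 / u) * ennreal (1 / v)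
      \<le> ennreal ((u * v) powr (- 1 / p)) * ennreal (K * (u * v)) * ennreal (1 / u) * ennreal (1 / v)"
      using bound[OF that] by (intro mult_right_mono mult_left_mono) auto
    also have "\<dots> = ennreal ((u * v) powr (- 1 / p) * (K * (u * v)) * (1 / u) * (1 / v))"
      using that assms by (intro ennreal_mult4) auto
    also have "(u * v) powr (- 1 / p) * (K * (u * v)) * (1 / u) * (1 / v)
        = K * v powr (- 1 / p) * u powr (- 1 / p)"
      using that by (simp add: powr_mult)
    finally show ?thesis
      using assms by (simp add: ennreal_mult' ennreal_mult'')
  qed
  have "I_functional p f \<le> (\<integral>\<^sup>+ v. (\<integral>\<^sup>+ u. ennreal K * g v * g u \<partial>lborel) \<partial>lborel)"
    unfolding I_functional_def
  proof (intro nn_integral_mono)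
    fix v :: real
    show "(\<integral>\<^sup>+ u \<in> {0<..<1}. ennreal ((u * v) powr (- 1 / p)) * mixed_modulus p f u v
        * ennreal (1 / u) * ennreal (1 / v) \<partial>lborel) * indicator {0<..<1} v
      \<le> (\<integral>\<^sup>+ u. ennreal K * g v * g u \<partial>lborel)"
    proof (cases "v \<in> {0<..<1}")
      case True
      then show ?thesis
        by (simp, intro nn_integral_mono) (use pt in \<open>auto simp: g_def indicator_def\<close>)
    qed simp
  qed
  also have "\<dots> = (\<integral>\<^sup>+ v. ennreal K * ennreal (conj_exp p) * g v \<partial>lborel)"
    by (simp add: nn_integral_cmult g_int mult_ac)
  also have "\<dots> = ennreal K * ennreal (conj_exp p) * ennreal (conj_exp p)"
    by (simp add: nn_integral_cmult g_int)
  also have "\<dots> = ennreal (K * (conj_exp p)\<^sup>2)"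
    using assms \<open>0 \<le> conj_exp p\<close> by (simp add: ennreal_mult power2_eq_square mult.assoc)
  finally show ?thesis .
qed

section \<open>A product of cosines as test function\<close>

definition cos_cos :: "real \<times> real \<Rightarrow> real" where
  "cos_cos = (\<lambda>(x, y). cos (2 * pi * x) * cos (2 * pi * y))"

lemma continuous_cos_cos: "continuous_on A cos_cos"
  unfolding cos_cos_def case_prod_beta by (intro continuous_intros)

lemma cos_cos_in_Lp2:
  assumes "0 < p"
  shows "cos_cos \<in> Lp2 p"
proof -
  have "cos (2 * pi * (x + 1)) = cos (2 * pi * x)" for x
    using cos_periodic[of "2 * pi * x"] by (simp add: algebra_simps)
  then have "periodic2 cos_cos"
    by (simp add: periodic2_def cos_cos_def)
  moreover have "cos_cos \<in> borel_measurable lebesgue"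
    using continuous_cos_cos
    by (intro measurable_completion) (simp add: borel_measurable_continuous_onI)
  moreover have "\<bar>cos_cos z\<bar> \<le> 1" for z
    by (auto simp: cos_cos_def case_prod_beta abs_mult intro!: mult_le_one)
  then have "Lp_norm2 p cos_cos \<le> ennreal 1"
    using assms by (intro Lp_norm2_le) auto
  then have "Lp_norm2 p cos_cos < \<infinity>"
    using le_less_trans by fastforce
  ultimately show ?thesis
    by (simp add: Lp2_def)
qed

lemma abs_cos_diff_le: "\<bar>cos a - cos b\<bar> \<le> \<bar>a - b\<bar>" for a b :: real
proof -
  have "\<bar>cos a - cos b\<bar> = 2 * \<bar>sin ((a + b) / 2)\<bar> * \<bar>sin ((b - a) / 2)\<bar>"
    by (simp add: cos_diff_cos abs_mult)
  also have "\<dots> \<le> 2 * 1 * \<bar>(b - a) / 2\<bar>"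
    by (intro mult_mono abs_sin_x_le_abs_x) auto
  finally show ?thesis
    by simp
qed

lemma mixed_modulus_cos_cos_le:
  assumes "0 < p" "0 \<le> u" "0 \<le> v"
  shows "mixed_modulus p cos_cos u v \<le> ennreal (4 * pi\<^sup>2 * (u * v))"
proof -
  have "Lp_norm2 p (mixed_diff s t cos_cos) \<le> ennreal (4 * pi\<^sup>2 * (u * v))"
    if s: "0 \<le> s" "s \<le> u" and t: "0 \<le> t" "t \<le> v" for s t
  proof (rule Lp_norm2_le)
    fix z :: "real \<times> real"
    obtain x y where z: "z = (x, y)"
      by fastforce
    have shift: "\<bar>cos (2 * pi * (a + h)) - cos (2 * pi * a)\<bar> \<le> 2 * pi * h" if "0 \<le> h" for a h
      using abs_cos_diff_le[of "2 * pi * (a + h)" "2 * pi * a"] that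
      by (simp add: algebra_simps)
    have "mixed_diff s t cos_cos z = (cos (2 * pi * (x + s)) - cos (2 * pi * x))
        * (cos (2 * pi * (y + t)) - cos (2 * pi * y))"
      unfolding z mixed_diff_def cos_cos_def by (simp only: prod.case) algebra
    then have "\<bar>mixed_diff s t cos_cos z\<bar> \<le> (2 * pi * s) * (2 * pi * t)"
      using shift[OF s(1), of x] shift[OF t(1), of y] s
      by (auto simp only: abs_mult intro!: mult_mono)
    also have "\<dots> \<le> (2 * pi * u) * (2 * pi * v)"
      using s t assms by (intro mult_mono) auto
    finally show "\<bar>mixed_diff s t cos_cos z\<bar> \<le> 4 * pi\<^sup>2 * (u * v)"
      by (simp add: power2_eq_square mult_ac)
  qed (use assms in auto)
  then show ?thesis
    unfolding mixed_modulus_def by (intro SUP_least) auto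
qed

text \<open>
  At the half-integers \<open>cos (2 \<pi> x)\<close> alternates between \<open>1\<close> and \<open>-1\<close>, so on the net of step \<open>1/2\<close>
  the mixed difference over a cell is \<open>\<plusminus>4\<close>; keeping one cell makes the bound independent of \<open>p\<close>.
\<close>
lemma v2_variation_cos_cos_ge:
  assumes "0 < p"
  shows "ennreal 4 \<le> v2_variation p cos_cos"
proof -
  define x :: "nat \<Rightarrow> real" where "x i = real i / 2" for i
  have part: "period_partition 2 x"
    by (auto simp: period_partition_def x_def strict_mono_on_def)
  define T where "T i j = \<bar>cos_cos (x (Suc i), x (Suc j)) - cos_cos (x (Suc i), x j)
      - cos_cos (x i, x (Suc j)) + cos_cos (x i, x j)\<bar> powr p" for i j
  have "4 powr p = T 0 0"
    by (simp add: T_def cos_cos_def x_def)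
  also have "\<dots> \<le> (\<Sum>j<2. T 0 j)"
    by (intro member_le_sum) (auto simp: T_def)
  also have "\<dots> \<le> (\<Sum>i<2. \<Sum>j<2. T i j)"
    by (rule member_le_sum[where f = "\<lambda>i. \<Sum>j<2. T i j"]) (auto simp: T_def intro!: sum_nonneg)
  also have "\<dots> = net_sum p cos_cos 2 x 2 x"
    by (simp add: net_sum_def T_def)
  finally have "(4 powr p) powr (1 / p) \<le> net_sum p cos_cos 2 x 2 x powr (1 / p)"
    using assms by (intro powr_mono2) auto
  then have "4 \<le> net_sum p cos_cos 2 x 2 x powr (1 / p)"
    using assms by (simp add: powr_powr)
  then show ?thesis
    unfolding v2_variation_def using part
    by (intro SUP_upper2[of "(2, x, 2, x)"]) (auto intro: ennreal_leI)
qed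

section \<open>Sharpness of the order of the constant\<close>

theorem mainTheorem7:
  shows "\<not> (\<exists>(A :: real) (c :: real \<Rightarrow> real).
            A > 0
          \<and> (\<forall>p. 1 < p \<and> p \<le> 2 \<longrightarrow> c p \<ge> 0)
          \<and> Liminf (at_right 1) (\<lambda>p. ereal ((conj_exp p)\<^sup>2 * c p)) = 0
          \<and> (\<forall>p f. 1 < p \<and> p \<le> 2 \<and> continuous_on UNIV f \<and> f \<in> Lp2 p \<and> I_functional p f < \<infinity>
                \<longrightarrow> v2_variation p f \<le> ennreal (A * c p) * I_functional p f))"
proof (rule notI, elim exE conjE)
  fix A :: real and c :: "real \<Rightarrow> real"
  assume A: "A > 0"
    and c: "\<forall>p. 1 < p \<and> p \<le> 2 \<longrightarrow> c p \<ge> 0"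
    and lim: "Liminf (at_right 1) (\<lambda>p. ereal ((conj_exp p)\<^sup>2 * c p)) = 0"
    and ineq: "\<forall>p f. 1 < p \<and> p \<le> 2 \<and> continuous_on UNIV f \<and> f \<in> Lp2 p \<and> I_functional p f < \<infinity>
                \<longrightarrow> v2_variation p f \<le> ennreal (A * c p) * I_functional p f"
  have lower: "1 / (A * pi\<^sup>2) \<le> (conj_exp p)\<^sup>2 * c p" if p: "1 < p" "p \<le> 2" for p
  proof -
    have I: "I_functional p cos_cos \<le> ennreal (4 * pi\<^sup>2 * (conj_exp p)\<^sup>2)"
      using p mixed_modulus_cos_cos_le by (intro I_functional_le) auto
    have "ennreal 4 \<le> v2_variation p cos_cos"
      using p by (intro v2_variation_cos_cos_ge) auto
    also have "\<dots> \<le> ennreal (A * c p) * I_functional p cos_cos"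
      using ineq p continuous_cos_cos cos_cos_in_Lp2[of p] I le_less_trans[OF I] by simp
    also have "\<dots> \<le> ennreal (A * c p) * ennreal (4 * pi\<^sup>2 * (conj_exp p)\<^sup>2)"
      using I by (intro mult_left_mono) auto
    also have "\<dots> = ennreal (A * c p * (4 * pi\<^sup>2 * (conj_exp p)\<^sup>2))"
      using A c p by (simp add: ennreal_mult')
    finally have "4 \<le> A * c p * (4 * pi\<^sup>2 * (conj_exp p)\<^sup>2)"
      using A c p by (subst (asm) ennreal_le_iff) auto
    then show ?thesis
      using A by (simp add: field_simps)
  qed
  have "eventually (\<lambda>p. ereal (1 / (A * pi\<^sup>2)) \<le> ereal ((conj_exp p)\<^sup>2 * c p)) (at_right 1)"
    by (rule eventually_mono[OF eventually_at_right_real[of 1 2]]) (use lower in auto)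
  then have "ereal (1 / (A * pi\<^sup>2)) \<le> Liminf (at_right 1) (\<lambda>p. ereal ((conj_exp p)\<^sup>2 * c p))"
    by (rule Liminf_bounded)
  then have "1 / (A * pi\<^sup>2) \<le> 0"
    using lim by (simp add: zero_ereal_def)
  moreover have "0 < 1 / (A * pi\<^sup>2)"
    using A by simp
  ultimately show False
    by linarith
qed

end
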